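(* Let $s_1,\dots,s_n\in\{0,1\}^m$ with $n\ge 3$, let $k$ be an integer, let $\mathrm{OPT}=\min\{\max_i\mathrm{H}(s,s_i): s\in\{0,1\}^m,\ \mathrm{ones}(s)=k\}$, and let $\epsilon\in(0,1)$ satisfy $\mathrm{OPT}\ge\frac{122\ln n}{\epsilon^2}$. Let $(x_1^*,\dots,x_m^*,d^* )$ be an optimal solution of the linear program: minimize $d$ subject to $\sum_{j=1}^m x_j=k$; $\sum_{j: s_i[j]=1}(1-x_j)+\sum_{j: s_i[j]=0}x_j\le d$ for all $i=1,\dots,n$; $x_j\in[0,1]$ for all $j$. Let $x\in\{0,1\}^m$ be random, with the letters $x[j]$ independent and $\Pr[x[j]=1]=x_j^*$. Then \[\Pr\left[\max_{i}\mathrm{H}(x,s_i)>\left(1+\tfrac{\epsilon}{2}\right)\mathrm{OPT}\right]\le\tfrac14.\]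
   Context: $\mathrm{H}$ denotes Hamming distance, $\mathrm{ones}(s)$ the number of $1$'s in $s$, and $s[j]$ the $j$-th letter of $s$. *)

theory Defs
  imports "HOL-Probability.Probability"
begin

text \<open>Strings over \<open>{0,1}\<close> are Boolean lists, with \<open>True\<close> as the letter 1. Letter positions are
  numbered from 0, so they range over \<open>{..<m}\<close>; the input strings are \<open>s 1, \<dots>, s n\<close>.\<close>

definition ones :: "bool list \<Rightarrow> nat" where
  "ones s = count_list s True"

text \<open>Only meant for strings of equal length.\<close>
definition hamming :: "bool list \<Rightarrow> bool list \<Rightarrow> nat" where
  "hamming s t = card {j. j < length s \<and> s ! j \<noteq> t ! j}"

definition max_dist :: "nat \<Rightarrow> (nat \<Rightarrow> bool list) \<Rightarrow> bool list \<Rightarrow> nat" where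
  "max_dist n s t = Max ((\<lambda>i. hamming t (s i)) ` {1..n})"

text \<open>Unspecified if no string of length \<open>m\<close> has exactly \<open>k\<close> ones, i.e. unless
  \<open>0 \<le> k \<le> m\<close>. In that case \<open>lp_feasible\<close> below is unsatisfiable as well.\<close>
definition OPT :: "nat \<Rightarrow> nat \<Rightarrow> int \<Rightarrow> (nat \<Rightarrow> bool list) \<Rightarrow> nat" where
  "OPT m n k s = Min {max_dist n s t | t. length t = m \<and> int (ones t) = k}"

definition lp_feasible ::
  "nat \<Rightarrow> nat \<Rightarrow> int \<Rightarrow> (nat \<Rightarrow> bool list) \<Rightarrow> (nat \<Rightarrow> real) \<Rightarrow> real \<Rightarrow> bool" where
  "lp_feasible m n k s x d \<longleftrightarrow>
     (\<Sum>j<m. x j) = of_int k \<and>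
     (\<forall>i\<in>{1..n}. (\<Sum>j\<in>{j. j < m \<and> s i ! j}. 1 - x j) + (\<Sum>j\<in>{j. j < m \<and> \<not> s i ! j}. x j) \<le> d) \<and>
     (\<forall>j<m. x j \<in> {0..1})"

definition lp_optimal ::
  "nat \<Rightarrow> nat \<Rightarrow> int \<Rightarrow> (nat \<Rightarrow> bool list) \<Rightarrow> (nat \<Rightarrow> real) \<Rightarrow> real \<Rightarrow> bool" where
  "lp_optimal m n k s x d \<longleftrightarrow>
     lp_feasible m n k s x d \<and> (\<forall>y e. lp_feasible m n k s y e \<longrightarrow> d \<le> e)"

end

theory Submission
  imports Defs
begin

text \<open>A string attaining the optimum is a feasible point of the linear program, so its optimal
  value is at most the optimum; hence each distance has expectation at most the optimum. A distance
  is a sum of independent indicators, so a Chernoff bound and a union bound over the \<open>n\<close> strings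
  finish the proof.\<close>

text \<open>Since \<open>of_bool\<close> takes only two values, the exponential is an affine
  function of the indicator of the event \<open>B\<close>; integrability and the mean follow by
  linearity.\<close>

lemma (in prob_space) expectation_exp_of_bool:
  fixes l :: real
  assumes [measurable]: "random_variable (count_space UNIV) B"
  shows "integrable M (\<lambda>\<omega>. exp (l * of_bool (B \<omega>)))"
    and "expectation (\<lambda>\<omega>. exp (l * of_bool (B \<omega>))) = 1 + (exp l - 1) * prob {\<omega> \<in> space M. B \<omega>}"
proof -
  let ?A = "{\<omega> \<in> space M. B \<omega>}"
  have [measurable]: "?A \<in> events"
    by measurable
  have eq: "exp (l * of_bool (B \<omega>)) = 1 + (exp l - 1) * indicator ?A \<omega>" if "\<omega> \<in> space M" for \<omega>
    using that by (auto simp: indicator_def)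
  have int: "integrable M (\<lambda>\<omega>. (exp l - 1) * indicator ?A \<omega> :: real)"
    by (intro integrable_mult_right integrable_real_indicator) (auto simp: less_top[symmetric])
  have "integrable M (\<lambda>\<omega>. 1 + (exp l - 1) * indicator ?A \<omega> :: real)"
    using int by simp
  then show "integrable M (\<lambda>\<omega>. exp (l * of_bool (B \<omega>)))"
    by (subst Bochner_Integration.integrable_cong[OF refl eq])
  have "expectation (\<lambda>\<omega>. exp (l * of_bool (B \<omega>))) =
      expectation (\<lambda>\<omega>. 1 + (exp l - 1) * indicator ?A \<omega>)"
    by (rule Bochner_Integration.integral_cong[OF refl eq])
  also have "\<dots> = 1 + (exp l - 1) * prob ?A"
    using int by (simp add: prob_space Int_absorb1 subsetI)
  finally show "expectation (\<lambda>\<omega>. exp (l * of_bool (B \<omega>))) = 1 + (exp l - 1) * prob ?A" .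
qed

text \<open>Exponential moment method. The mean enters only through an upper bound \<open>D\<close>,
  since the linear program bounds the expected distances from above without fixing them.\<close>

lemma (in prob_space) Chernoff_sum_of_bool:
  fixes B :: "'i \<Rightarrow> 'a \<Rightarrow> bool" and \<delta> D :: real
  assumes fin: "finite I"
    and indep: "indep_vars (\<lambda>_. count_space UNIV) B I"
    and mean: "(\<Sum>j\<in>I. prob {\<omega> \<in> space M. B j \<omega>}) \<le> D"
    and \<delta>: "0 < \<delta>" "\<delta> \<le> 2"
  shows "prob {\<omega> \<in> space M. (\<Sum>j\<in>I. of_bool (B j \<omega>)) \<ge> (1 + \<delta>) * D} \<le> exp (- \<delta>\<^sup>2 * D / 4)"
proof -
  \<comment> \<open>minimises \<open>l\<^sup>2 - \<delta> l\<close>, the factor of \<open>D\<close> in the final exponent\<close>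
  define l where "l = \<delta> / 2"
  have l: "0 < l" "l \<le> 1"
    using \<delta> by (auto simp: l_def)
  have rv: "random_variable (count_space UNIV) (B j)" if "j \<in> I" for j
    using indep that by (auto simp: indep_vars_def)
  let ?X = "\<lambda>j \<omega>. exp (l * of_bool (B j \<omega>)) :: real"
  let ?p = "\<lambda>j. prob {\<omega> \<in> space M. B j \<omega>}"
  have indX: "indep_vars (\<lambda>_. borel) ?X I"
    by (rule indep_vars_compose2[OF indep, where Y = "\<lambda>_ b. exp (l * of_bool b)"]) simp
  have intX: "integrable M (?X j)" if "j \<in> I" for j
    using expectation_exp_of_bool(1)[OF rv[OF that]] .
  have prod: "exp (l * (\<Sum>j\<in>I. of_bool (B j \<omega>))) = (\<Prod>j\<in>I. ?X j \<omega>)" for \<omega>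
    unfolding sum_distrib_left by (rule exp_sum[OF fin])
  have int: "integrable M (\<lambda>\<omega>. exp (l * (\<Sum>j\<in>I. of_bool (B j \<omega>))))"
    unfolding prod by (rule indep_vars_integrable[OF fin indX intX])
  have D: "0 \<le> D"
    using mean by (meson measure_nonneg order_trans sum_nonneg)
  \<comment> \<open>This quadratic bound is taken on \<open>0 \<le> l \<le> 1\<close>, which is
    where \<open>\<delta> \<le> 2\<close> enters.\<close>
  have el: "exp l - 1 \<le> l + l\<^sup>2"
    using exp_bound[of l] l by simp
  have "expectation (\<lambda>\<omega>. exp (l * (\<Sum>j\<in>I. of_bool (B j \<omega>)))) = (\<Prod>j\<in>I. expectation (?X j))"
    unfolding prod by (rule indep_vars_lebesgue_integral[OF fin indX intX])
  also have "\<dots> = (\<Prod>j\<in>I. 1 + (exp l - 1) * ?p j)"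
    by (intro prod.cong refl expectation_exp_of_bool(2) rv)
  \<comment> \<open>By \<open>1 + z \<le> exp z\<close> the product becomes a single exponential
    that depends on the probabilities only through their sum.\<close>
  also have "\<dots> \<le> (\<Prod>j\<in>I. exp ((exp l - 1) * ?p j))"
    using l by (intro prod_mono conjI exp_ge_add_one_self add_nonneg_nonneg mult_nonneg_nonneg) auto
  also have "\<dots> = exp ((exp l - 1) * (\<Sum>j\<in>I. ?p j))"
    by (simp add: exp_sum fin sum_distrib_left)
  also have "\<dots> \<le> exp ((l + l\<^sup>2) * D)"
    using mean el l D by (auto intro!: mult_mono sum_nonneg)
  finally have mgf: "expectation (\<lambda>\<omega>. exp (l * (\<Sum>j\<in>I. of_bool (B j \<omega>)))) \<le> exp ((l + l\<^sup>2) * D)" .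
  \<comment> \<open>Markov's inequality for the exponential of the sum. The library states it with a
    set integral, which over \<open>space M\<close> is the expectation.\<close>
  have "prob {\<omega> \<in> space M. (\<Sum>j\<in>I. of_bool (B j \<omega>)) \<ge> (1 + \<delta>) * D}
      \<le> exp (- l * ((1 + \<delta>) * D)) *
        (\<integral>\<omega>\<in>space M. exp (l * (\<Sum>j\<in>I. of_bool (B j \<omega>))) \<partial>M)"
    using l int
    by (intro Chernoff_ineq_ge) (simp_all add: set_integrable_def integrable_mult_indicator
        del: real_scaleR_def)
  also have "\<dots> = exp (- l * ((1 + \<delta>) * D)) *
      expectation (\<lambda>\<omega>. exp (l * (\<Sum>j\<in>I. of_bool (B j \<omega>))))"
    using int by (subst set_integral_space) auto
  also have "\<dots> \<le> exp (- l * ((1 + \<delta>) * D)) * exp ((l + l\<^sup>2) * D)"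
    using mgf by simp
  also have "\<dots> = exp (- \<delta>\<^sup>2 * D / 4)"
    unfolding exp_add[symmetric] by (simp add: l_def power2_eq_square field_simps)
  finally show ?thesis .
qed

text \<open>Merges the two sums of a constraint. The merged weight is the probability that a letter
  equal to 1 with probability \<open>y j\<close> differs from \<open>P j\<close>; for 0/1 values of
  \<open>y\<close> it is the mismatch indicator.\<close>

lemma sum_mismatch_weights:
  fixes y :: "nat \<Rightarrow> real"
  shows "(\<Sum>j\<in>{j. j < m \<and> P j}. 1 - y j) + (\<Sum>j\<in>{j. j < m \<and> \<not> P j}. y j) =
    (\<Sum>j<m. if P j then 1 - y j else y j)"
  by (simp add: sum.If_cases Int_def lessThan_def Collect_neg_eq[symmetric])

lemma hamming_eq_sum:
  assumes "length t = m"
  shows "real (hamming t u) = (\<Sum>j<m. of_bool (t ! j \<noteq> u ! j))"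
  using assms by (simp add: hamming_def sum_of_bool_eq Int_def)

lemma ones_eq_sum:
  "real (ones t) = (\<Sum>j<length t. of_bool (t ! j))"
  by (simp add: ones_def count_list_eq_length_filter length_filter_conv_card sum_of_bool_eq
      Int_def)

text \<open>At a 0/1 point the left side of constraint \<open>i\<close> is exactly the Hamming
  distance to \<open>s i\<close>, and the coordinates sum to the number of ones.\<close>

lemma string_lp_feasible:
  assumes len: "length t = m" and k: "int (ones t) = k"
  shows "lp_feasible m n k s (\<lambda>j. of_bool (t ! j)) (real (max_dist n s t))"
proof -
  have "(\<Sum>j\<in>{j. j < m \<and> s i ! j}. 1 - of_bool (t ! j)) +
      (\<Sum>j\<in>{j. j < m \<and> \<not> s i ! j}. of_bool (t ! j)) \<le> real (max_dist n s t)"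
    if "i \<in> {1..n}" for i
  proof -
    have "(\<Sum>j<m. if s i ! j then 1 - of_bool (t ! j) else of_bool (t ! j)) =
        real (hamming t (s i))"
      unfolding hamming_eq_sum[OF len] by (intro sum.cong) auto
    also have "\<dots> \<le> real (max_dist n s t)"
      using that by (auto simp: max_dist_def intro!: Max_ge)
    finally show ?thesis
      unfolding sum_mismatch_weights .
  qed
  moreover have "(\<Sum>j<m. of_bool (t ! j)) = real_of_int k"
    using ones_eq_sum[of t] len k by auto
  ultimately show ?thesis
    by (auto simp: lp_feasible_def)
qed

text \<open>Ensures that the minimum in \<open>OPT\<close> ranges over a nonempty set: a sum of
  \<open>m\<close> numbers in the unit interval forces \<open>0 \<le> k \<le> m\<close>, so
  \<open>k\<close> ones followed by \<open>m - k\<close> zeros will do.\<close>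

lemma lp_feasible_imp_ex_string:
  assumes "lp_feasible m n k s y d"
  shows "\<exists>t. length t = m \<and> int (ones t) = k"
proof -
  have k: "(\<Sum>j<m. y j) = of_int k" and y: "\<And>j. j < m \<Longrightarrow> y j \<in> {0..1}"
    using assms by (auto simp: lp_feasible_def)
  have "0 \<le> (\<Sum>j<m. y j)"
    using y by (intro sum_nonneg) auto
  moreover have "(\<Sum>j<m. y j) \<le> (\<Sum>j<m. 1)"
    using y by (intro sum_mono) auto
  ultimately have "0 \<le> k" "k \<le> int m"
    unfolding k by auto
  then have "length (replicate (nat k) True @ replicate (m - nat k) False) = m"
    "int (ones (replicate (nat k) True @ replicate (m - nat k) False)) = k"
    by (auto simp: ones_def count_list_eq_length_filter)
  then show ?thesis
    by blast
qed

lemma OPT_attained: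
  assumes "lp_feasible m n k s y d"
  obtains t where "length t = m" "int (ones t) = k" "OPT m n k s = max_dist n s t"
proof -
  let ?T = "{t :: bool list. length t = m \<and> int (ones t) = k}"
  have eq: "{max_dist n s t | t. length t = m \<and> int (ones t) = k} = max_dist n s ` ?T"
    by auto
  have "?T \<subseteq> {t. set t \<subseteq> UNIV \<and> length t = m}"
    by auto
  then have "finite ?T"
    using finite_lists_length_eq[OF finite] by (rule finite_subset)
  moreover have "?T \<noteq> {}"
    using lp_feasible_imp_ex_string[OF assms] by auto
  ultimately have "OPT m n k s \<in> max_dist n s ` ?T"
    unfolding OPT_def eq by (intro Min_in) auto
  then show ?thesis
    using that by auto
qed

lemma lp_optimal_le_OPT:
  assumes "lp_optimal m n k s y d"
  shows "d \<le> real (OPT m n k s)"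
proof -
  have "lp_feasible m n k s y d"
    using assms by (simp add: lp_optimal_def)
  then obtain t where "length t = m" "int (ones t) = k" "OPT m n k s = max_dist n s t"
    by (rule OPT_attained)
  then show ?thesis
    using assms string_lp_feasible[of t m k n s] by (auto simp: lp_optimal_def)
qed

theorem lemma3:
  fixes m n :: nat and k :: int and s :: "nat \<Rightarrow> bool list" and \<epsilon> :: real
    and xopt :: "nat \<Rightarrow> real" and dopt :: real
    and M :: "'a measure" and x :: "'a \<Rightarrow> bool list"
  assumes "n \<ge> 3"
    and "\<forall>i\<in>{1..n}. length (s i) = m"
    and "\<epsilon> \<in> {0<..<1}"
    and "real (OPT m n k s) \<ge> 122 * ln (real n) / \<epsilon>\<^sup>2"
    and "lp_optimal m n k s xopt dopt"
    and "prob_space M"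
    and "\<forall>\<omega>\<in>space M. length (x \<omega>) = m"
    and "prob_space.indep_vars M (\<lambda>_. count_space UNIV) (\<lambda>j \<omega>. x \<omega> ! j) {..<m}"
    and "\<forall>j<m. measure M {\<omega> \<in> space M. x \<omega> ! j} = xopt j"
  shows "measure M {\<omega> \<in> space M.
           real (max_dist n s (x \<omega>)) > (1 + \<epsilon> / 2) * real (OPT m n k s)} \<le> 1 / 4"
proof -
  interpret prob_space M
    by fact
  let ?D = "real (OPT m n k s)"
  define B where "B = (\<lambda>i j \<omega>. x \<omega> ! j \<noteq> s i ! j)"
  \<comment> \<open>The threshold is non-strict, as in the Chernoff bound; the strict event of the
    goal is contained in the union of these.\<close>
  define bad where "bad = (\<lambda>i. {\<omega> \<in> space M. (\<Sum>j<m. of_bool (B i j \<omega>)) \<ge> (1 + \<epsilon> / 2) * ?D})"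
  have rvx: "random_variable (count_space UNIV) (\<lambda>\<omega>. x \<omega> ! j)" if "j < m" for j
    using assms(8) that by (auto simp: indep_vars_def)
  \<comment> \<open>For fixed \<open>i\<close>, the mismatch at position \<open>j\<close> is a
    function of the letter at \<open>j\<close> alone, so independence carries over.\<close>
  have indep: "indep_vars (\<lambda>_. count_space UNIV) (B i) {..<m}" for i
    unfolding B_def
    by (rule indep_vars_compose2[OF assms(8), where Y = "\<lambda>j b. b \<noteq> s i ! j"]) simp
  have rvB: "random_variable (count_space UNIV) (B i j)" if "j < m" for i j
    using indep that by (auto simp: indep_vars_def)
  \<comment> \<open>These are the merged weights of constraint \<open>i\<close> at
    \<open>xopt\<close>, so the expected distance to \<open>s i\<close> is the left side of that
    constraint.\<close>
  have probB: "prob {\<omega> \<in> space M. B i j \<omega>} = (if s i ! j then 1 - xopt j else xopt j)"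
    if "j < m" for i j
  proof -
    have "{\<omega> \<in> space M. x \<omega> ! j} \<in> events"
      using rvx[OF that] by measurable
    then have "prob {\<omega> \<in> space M. \<not> x \<omega> ! j} = 1 - xopt j"
      using assms(9) that by (subst prob_neg) auto
    then show ?thesis
      using assms(9) that by (auto simp: B_def)
  qed
  have bad_event: "bad i \<in> events" for i
  proof -
    have "(\<lambda>\<omega>. \<Sum>j<m. of_bool (B i j \<omega>) :: real) \<in> borel_measurable M"
      by (intro borel_measurable_sum measurable_compose[OF rvB]) auto
    then show ?thesis
      unfolding bad_def by measurable
  qed
  have ln_n: "0 < ln (real n)"
    using assms(1) by simp
  have bad_prob: "prob (bad i) \<le> 1 / (real n) ^ 7" if i: "i \<in> {1..n}" for i
  proof -
    have "(\<Sum>j<m. prob {\<omega> \<in> space M. B i j \<omega>}) = (\<Sum>j<m. if s i ! j then 1 - xopt j else xopt j)"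
      by (intro sum.cong refl probB) auto
    also have "\<dots> \<le> dopt"
      using assms(5) i unfolding sum_mismatch_weights[symmetric]
      by (auto simp: lp_optimal_def lp_feasible_def)
    also have "\<dots> \<le> ?D"
      by (rule lp_optimal_le_OPT) fact
    finally have "prob (bad i) \<le> exp (- (\<epsilon> / 2)\<^sup>2 * ?D / 4)"
      unfolding bad_def using assms(3) by (intro Chernoff_sum_of_bool indep) auto
    \<comment> \<open>The exponent is \<open>\<epsilon>\<^sup>2 * ?D / 16\<close>, at least
      \<open>122 / 16 = 7.625\<close> times \<open>ln n\<close>. As \<open>ln n\<close> is positive,
      the factor can be lowered to 7, giving an integer power of \<open>n\<close>.\<close>
    also have "\<dots> \<le> exp (- (7 * ln (real n)))"
    proof -
      have "122 * ln (real n) \<le> ?D * \<epsilon>\<^sup>2"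
        using assms(3,4) by (simp add: pos_divide_le_eq)
      then show ?thesis
        using ln_n by (simp add: power_divide mult.commute)
    qed
    also have "\<dots> = 1 / (real n) ^ 7"
      using assms(1) exp_of_nat_mult[of 7 "ln (real n)"] by (simp add: exp_minus inverse_eq_divide)
    finally show ?thesis .
  qed
  have "{\<omega> \<in> space M. real (max_dist n s (x \<omega>)) > (1 + \<epsilon> / 2) * ?D} \<subseteq> (\<Union>i\<in>{1..n}. bad i)"
  proof
    fix \<omega> assume "\<omega> \<in> {\<omega> \<in> space M. real (max_dist n s (x \<omega>)) > (1 + \<epsilon> / 2) * ?D}"
    then have \<omega>: "\<omega> \<in> space M" "real (max_dist n s (x \<omega>)) > (1 + \<epsilon> / 2) * ?D"
      by auto
    \<comment> \<open>The maximum is attained at some index, because \<open>n \<ge> 3\<close> makes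
      the index set nonempty; that index witnesses membership in the union.\<close>
    have "max_dist n s (x \<omega>) \<in> (\<lambda>i. hamming (x \<omega>) (s i)) ` {1..n}"
      unfolding max_dist_def using assms(1) by (intro Max_in) auto
    then obtain i where "i \<in> {1..n}" "max_dist n s (x \<omega>) = hamming (x \<omega>) (s i)"
      by auto
    then show "\<omega> \<in> (\<Union>i\<in>{1..n}. bad i)"
      using \<omega> assms(7) hamming_eq_sum[of "x \<omega>" m "s i"]
      by (auto simp: bad_def B_def intro!: bexI[of _ i])
  qed
  then have "prob {\<omega> \<in> space M. real (max_dist n s (x \<omega>)) > (1 + \<epsilon> / 2) * ?D}
      \<le> prob (\<Union>i\<in>{1..n}. bad i)"
    using bad_event by (intro finite_measure_mono) auto
  also have "\<dots> \<le> (\<Sum>i\<in>{1..n}. prob (bad i))"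
    using bad_event by (intro finite_measure_subadditive_finite) auto
  also have "\<dots> \<le> (\<Sum>i\<in>{1..n}. 1 / (real n) ^ 7)"
    by (intro sum_mono bad_prob)
  \<comment> \<open>The union bound over \<open>n\<close> strings costs one factor \<open>n\<close>;
    what remains is at most \<open>1 / 729\<close> by \<open>n \<ge> 3\<close>.\<close>
  also have "\<dots> = 1 / (real n) ^ 6"
    using assms(1) by (simp add: power_numeral_reduce)
  also have "\<dots> \<le> 1 / 3 ^ 6"
    using assms(1) by (intro divide_left_mono power_mono) auto
  also have "\<dots> \<le> 1 / 4"
    by simp
  finally show ?thesis .
qed

end
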